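(* Assume that $f_{\mathcal H}$ is $L$-smooth, that the honest local objectives satisfy the $(G,B)$-bounded dissimilarity condition, that the stochastic gradients satisfy the stochastic first-order oracle assumption with variance bound $\sigma^2$, and that the aggregation rule $\mathcal A$ is $(b,\kappa)$-robust. Let $0<\delta<1/4$ be any fixed constant. If $$\kappa B^2<\frac{1-4\delta}{1+2\delta}$$ and the stepsizes satisfy $\gamma_t\equiv\gamma$ with $0<\gamma\le \delta/L$, then for every integer $T>0$ the iterates $\{x^t\}_{t=0}^{T-1}$ generated by R-DSGD satisfy $$\frac1T\sum_{t=0}^{T-1}\mathbb E\left[\|\nabla f_{\mathcal H}(x^t)\|^2\right]\le \frac{\Delta_0}{C_1\gamma T}+\frac{2\gamma L\sigma^2}{C_1 h}+C_2\left(\kappa\sigma^2+\kappa G^2\right),$$ where $\Delta_0=f_{\mathcal H}(x^0)-f_{\mathcal H}^*$, $C_1=\frac12-2\delta-\kappa B^2\left(\frac12+\delta\right)$ (so that $C_1=\mathcal O(1-\kappa B^2)$), and $C_2=\left(\frac12+\delta\right)C_1^{-1}$.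
   Context: Setting. There are $n$ workers and a central server; $b<n/2$ workers may be Byzantine. $\mathcal H\subset[n]=\{1,\dots,n\}$ is the set of honest workers, $|\mathcal H|=h=n-b$. Worker $i$ has data distribution $\mathcal D_i$ and, for a loss $\ell$, differentiable local objective $f_i(x)=\mathbb E_{\xi_i\sim\mathcal D_i}[\ell(x,\xi_i)]$, $x\in\mathbb R^d$. The global objective is $f_{\mathcal H}=\frac1h\sum_{i\in\mathcal H}f_i$, and $f_{\mathcal H}^*=\inf_{x\in\mathbb R^d}f_{\mathcal H}(x)>-\infty$. $\|\cdot\|$ is the Euclidean norm and $\mathbb E$ the total expectation. R-DSGD (robust distributed SGD). Given a deterministic $x^0\in\mathbb R^d$, stepsizes $\gamma_t>0$ and an aggregation rule $\mathcal A:\mathbb R^{d\times n}\to\mathbb R^d$: for $t=1,2,\dots$, each honest worker $i\in\mathcal H$ sends a stochastic gradient $g_i^t=g_i(x^{t-1},\xi_i^t)$, where $\xi_i^t\sim\mathcal D_i$ is drawn afresh (independently of the past); each Byzantine worker $j$ sends an arbitrary vector $g_j^t\in\mathbb R^d$; the server sets $x^t=x^{t-1}-\gamma_t\,\mathcal A(g_1^t,\dots,g_n^t)$. $L$-smoothness: $f_{\mathcal H}$ is differentiable and $\nabla f_{\mathcal H}$ is Lipschitz continuous with constant $L>0$. $(G,B)$-bounded dissimilarity ($G,B\ge0$): $\frac1h\sum_{i\in\mathcal H}\|\nabla f_i(x)-\nabla f_{\mathcal H}(x)\|^2\le G^2+B^2\|\nabla f_{\mathcal H}(x)\|^2$ for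 all $x\in\mathbb R^d$. Stochastic first-order oracle: for each $i\in\mathcal H$ and all $x$, $\mathbb E_{\xi_i\sim\mathcal D_i}[g_i(x,\xi_i)]=\nabla f_i(x)$ and $\mathbb E_{\xi_i\sim\mathcal D_i}[\|g_i(x,\xi_i)-\nabla f_i(x)\|^2]\le\sigma^2$; the stochastic gradients of different workers are mutually independent. $(b,\kappa)$-robustness ($\kappa>0$, $b<n/2$): for all $x_1,\dots,x_n\in\mathbb R^d$ and every $S\subset[n]$ with $|S|=n-b$, $\|\mathcal A(x_1,\dots,x_n)-\bar x_S\|^2\le\frac{\kappa}{n-b}\sum_{i\in S}\|x_i-\bar x_S\|^2$, where $\bar x_S=\frac1{n-b}\sum_{i\in S}x_i$. *)

theory Defs
  imports "HOL-Probability.Probability" "HOL-Library.Landau_Symbols"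
begin

text \<open>
  Workers are the elements of a finite type \<open>'n\<close>, so that \<open>n = CARD('n)\<close>, and models live in
  \<open>real ^ 'd\<close>.  A tuple of \<open>n\<close> vectors is an element of \<open>real ^ 'd ^ 'n\<close>.
\<close>

section \<open>Objectives\<close>

definition gradient :: "('a::real_inner \<Rightarrow> real) \<Rightarrow> 'a \<Rightarrow> 'a" where
  "gradient f x = (THE D. GDERIV f x :> D)"

lemma GDERIV_gradient:
  fixes f :: "'a::euclidean_space \<Rightarrow> real"
  assumes "f differentiable (at x)"
  shows "GDERIV f x :> gradient f x"
proof -
  obtain f' where f': "(f has_derivative f') (at x)"
    using assms by (auto simp: differentiable_def)
  define D where "D = (\<Sum>b\<in>Basis. f' b *\<^sub>R b)"
  interpret bounded_linear f' using f' by (rule has_derivative_bounded_linear)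
  have "f' h = inner h D" for h
  proof -
    have "f' h = f' (\<Sum>b\<in>Basis. inner h b *\<^sub>R b)" by (simp add: euclidean_representation)
    also have "\<dots> = inner h D" by (simp add: D_def sum scaleR inner_sum_right mult.commute)
    finally show ?thesis .
  qed
  then have "f' = (\<lambda>h. inner h D)" by (rule ext)
  with f' have D: "GDERIV f x :> D" by (simp add: gderiv_def)
  have "E = D" if "GDERIV f x :> E" for E
  proof -
    have "(\<lambda>h. inner h E) = (\<lambda>h. inner h D)"
      using that D unfolding gderiv_def by (rule has_derivative_unique)
    then have "inner (E - D) E = inner (E - D) D" by meson
    then have "inner (E - D) (E - D) = 0" by (simp add: inner_diff_right)
    then show ?thesis by simp
  qed
  with D show ?thesis unfolding gradient_def by (rule theI)
qed

definition local_obj :: "('n \<Rightarrow> 'b measure) \<Rightarrow> (real ^ 'd \<Rightarrow> 'b \<Rightarrow> real) \<Rightarrow> 'n \<Rightarrow> real ^ 'd \<Rightarrow> real" where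
  "local_obj D \<l> i x = (\<integral>s. \<l> x s \<partial>D i)"

definition global_obj ::
    "('n \<Rightarrow> 'b measure) \<Rightarrow> (real ^ 'd \<Rightarrow> 'b \<Rightarrow> real) \<Rightarrow> 'n set \<Rightarrow> real ^ 'd \<Rightarrow> real" where
  "global_obj D \<l> H x = (\<Sum>i\<in>H. local_obj D \<l> i x) / real (card H)"

definition L_smooth :: "real \<Rightarrow> (real ^ 'd \<Rightarrow> real) \<Rightarrow> bool" where
  "L_smooth L f \<longleftrightarrow> (\<forall>x. f differentiable (at x)) \<and> L-lipschitz_on UNIV (gradient f)"

definition bounded_dissimilarity ::
    "real \<Rightarrow> real \<Rightarrow> ('n \<Rightarrow> 'b measure) \<Rightarrow> (real ^ 'd \<Rightarrow> 'b \<Rightarrow> real) \<Rightarrow> 'n set \<Rightarrow> bool" where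
  "bounded_dissimilarity G B D \<l> H \<longleftrightarrow>
     (\<forall>x. (\<Sum>i\<in>H. (norm (gradient (local_obj D \<l> i) x - gradient (global_obj D \<l> H) x))\<^sup>2) / real (card H)
          \<le> G\<^sup>2 + B\<^sup>2 * (norm (gradient (global_obj D \<l> H) x))\<^sup>2)"

section \<open>Aggregation\<close>

definition avg_over :: "'n set \<Rightarrow> real ^ 'd ^ 'n \<Rightarrow> real ^ 'd" where
  "avg_over S X = (1 / real (card S)) *\<^sub>R (\<Sum>i\<in>S. X $ i)"

definition robust_aggregator :: "nat \<Rightarrow> real \<Rightarrow> (real ^ 'd ^ 'n \<Rightarrow> real ^ 'd) \<Rightarrow> bool" where
  "robust_aggregator b \<kappa> A \<longleftrightarrow>
     (\<forall>X S. card S = CARD('n) - b \<longrightarrow>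
        (norm (A X - avg_over S X))\<^sup>2
          \<le> \<kappa> / real (CARD('n) - b) * (\<Sum>i\<in>S. (norm (X $ i - avg_over S X))\<^sup>2))"

section \<open>Sampling and the algorithm\<close>

text \<open>
  \<open>\<xi> t i\<close> is the sample of honest worker \<open>i\<close> in round \<open>t \<ge> 1\<close> and \<open>z t j\<close> the vector sent by
  Byzantine worker \<open>j\<close> in that round; both are random elements on the underlying probability space \<open>M\<close>.
  The vectors \<open>z t j\<close> are otherwise unrestricted: they may depend on all samples up to and
  including those of round \<open>t\<close>, and on private randomness.  The past of round \<open>t\<close> consists of
  everything sent or sampled in the rounds before \<open>t\<close>.
\<close>

definition past_events ::
    "'w measure \<Rightarrow> 'n set \<Rightarrow> ('n \<Rightarrow> 'b measure) \<Rightarrow> (nat \<Rightarrow> 'n \<Rightarrow> 'w \<Rightarrow> 'b)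
      \<Rightarrow> (nat \<Rightarrow> 'n \<Rightarrow> 'w \<Rightarrow> real ^ 'd) \<Rightarrow> nat \<Rightarrow> 'w set set" where
  "past_events M H D \<xi> z t =
     sigma_sets (space M)
       ({\<xi> s i -` S \<inter> space M | s i S. 1 \<le> s \<and> s < t \<and> i \<in> H \<and> S \<in> sets (D i)} \<union>
        {z s j -` S \<inter> space M | s j S. 1 \<le> s \<and> s < t \<and> j \<notin> H \<and> S \<in> sets borel})"

definition round_events ::
    "'w measure \<Rightarrow> 'n set \<Rightarrow> ('n \<Rightarrow> 'b measure) \<Rightarrow> (nat \<Rightarrow> 'n \<Rightarrow> 'w \<Rightarrow> 'b) \<Rightarrow> nat \<Rightarrow> 'w set set" where
  "round_events M H D \<xi> t =
     sigma_sets (space M) {\<xi> t i -` S \<inter> space M | i S. i \<in> H \<and> S \<in> sets (D i)}"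

definition fresh_sampling ::
    "'w measure \<Rightarrow> 'n set \<Rightarrow> ('n \<Rightarrow> 'b measure) \<Rightarrow> (nat \<Rightarrow> 'n \<Rightarrow> 'w \<Rightarrow> 'b)
      \<Rightarrow> (nat \<Rightarrow> 'n \<Rightarrow> 'w \<Rightarrow> real ^ 'd) \<Rightarrow> bool" where
  "fresh_sampling M H D \<xi> z \<longleftrightarrow>
     (\<forall>t\<ge>1. \<forall>i\<in>H. \<xi> t i \<in> M \<rightarrow>\<^sub>M D i \<and> distr M (D i) (\<xi> t i) = D i) \<and>
     (\<forall>t\<ge>1. \<forall>j. j \<notin> H \<longrightarrow> z t j \<in> borel_measurable M) \<and>
     (\<forall>t\<ge>1. prob_space.indep_set M (past_events M H D \<xi> z t) (round_events M H D \<xi> t))"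

text \<open>
  Joint measurability in \<open>(x, s)\<close> is what makes \<open>g i X (\<xi> t i)\<close> a random vector for a random
  point \<open>X\<close>.  Independence across workers is required at every fixed point \<open>x\<close>: at the random
  iterate the stochastic gradients share the iterate and are independent only conditionally on
  the past.
\<close>

definition stochastic_oracle ::
    "real \<Rightarrow> 'w measure \<Rightarrow> 'n set \<Rightarrow> ('n \<Rightarrow> 'b measure) \<Rightarrow> (real ^ 'd \<Rightarrow> 'b \<Rightarrow> real)
      \<Rightarrow> (nat \<Rightarrow> 'n \<Rightarrow> 'w \<Rightarrow> 'b) \<Rightarrow> ('n \<Rightarrow> real ^ 'd \<Rightarrow> 'b \<Rightarrow> real ^ 'd) \<Rightarrow> bool" where
  "stochastic_oracle \<sigma> M H D \<l> \<xi> g \<longleftrightarrow>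
     (\<forall>i\<in>H. case_prod (g i) \<in> borel_measurable (borel \<Otimes>\<^sub>M D i)) \<and>
     (\<forall>i\<in>H. \<forall>x. integrable (D i) (g i x) \<and> (\<integral>s. g i x s \<partial>D i) = gradient (local_obj D \<l> i) x) \<and>
     (\<forall>i\<in>H. \<forall>x. integrable (D i) (\<lambda>s. (norm (g i x s - gradient (local_obj D \<l> i) x))\<^sup>2) \<and>
        (\<integral>s. (norm (g i x s - gradient (local_obj D \<l> i) x))\<^sup>2 \<partial>D i) \<le> \<sigma>\<^sup>2) \<and>
     (\<forall>t\<ge>1. \<forall>x. prob_space.indep_vars M (\<lambda>_. borel) (\<lambda>i \<omega>. g i x (\<xi> t i \<omega>)) H)"

primrec rdsgd ::
    "(nat \<Rightarrow> real) \<Rightarrow> (real ^ 'd ^ 'n \<Rightarrow> real ^ 'd) \<Rightarrow> 'n set \<Rightarrow> ('n \<Rightarrow> real ^ 'd \<Rightarrow> 'b \<Rightarrow> real ^ 'd)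
      \<Rightarrow> (nat \<Rightarrow> 'n \<Rightarrow> 'w \<Rightarrow> 'b) \<Rightarrow> (nat \<Rightarrow> 'n \<Rightarrow> 'w \<Rightarrow> real ^ 'd) \<Rightarrow> real ^ 'd
      \<Rightarrow> nat \<Rightarrow> 'w \<Rightarrow> real ^ 'd" where
  "rdsgd \<gamma> A H g \<xi> z x0 0 \<omega> = x0"
| "rdsgd \<gamma> A H g \<xi> z x0 (Suc t) \<omega> =
     rdsgd \<gamma> A H g \<xi> z x0 t \<omega> -
     \<gamma> (Suc t) *\<^sub>R A (\<chi> i. if i \<in> H then g i (rdsgd \<gamma> A H g \<xi> z x0 t \<omega>) (\<xi> (Suc t) i \<omega>)
                          else z (Suc t) i \<omega>)"

section \<open>Constants of the rate\<close>

definition C1 :: "real \<Rightarrow> real \<Rightarrow> real \<Rightarrow> real" where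
  "C1 \<delta> \<kappa> B = 1/2 - 2 * \<delta> - \<kappa> * B\<^sup>2 * (1/2 + \<delta>)"

definition C2 :: "real \<Rightarrow> real \<Rightarrow> real \<Rightarrow> real" where
  "C2 \<delta> \<kappa> B = (1/2 + \<delta>) * inverse (C1 \<delta> \<kappa> B)"

end

theory Submission
  imports Defs
begin

text \<open>
  Write \<open>f\<close> for the global objective, \<open>x\<close> for the current iterate, \<open>a\<close> for the average of the honest
  stochastic gradients at \<open>x\<close> and \<open>r\<close> for the aggregated vector.  Robustness, together with the fact
  that a mean minimises the sum of squared distances, gives \<open>\<parallel>r - a\<parallel>\<^sup>2 \<le> \<kappa> s\<close>, where \<open>s\<close> is the mean
  squared distance of the honest gradients to \<open>\<nabla>f(x)\<close>.  Inserting \<open>r = a + (r - a)\<close> into the quadratic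
  upper bound of a smooth function and splitting with Young's inequality bounds the next objective
  value by
  \<open>f(x) - \<gamma>\<langle>\<nabla>f(x), a\<rangle> + (\<gamma>/2) \<parallel>\<nabla>f(x)\<parallel>\<^sup>2 + L \<gamma>\<^sup>2 \<parallel>a\<parallel>\<^sup>2 + (\<gamma>/2 + L \<gamma>\<^sup>2) \<kappa> s\<close>
  (\<open>step_le_robust_model\<close>).  The Byzantine messages have disappeared: this expression depends only on
  the iterate and on the fresh samples.

  At a fixed \<open>x\<close> its mean follows from three moments: \<open>a\<close> has mean \<open>\<nabla>f(x)\<close>, its variance is at most
  \<open>\<sigma>\<^sup>2/h\<close>, and the mean of \<open>s\<close> is at most \<open>\<sigma>\<^sup>2 + G\<^sup>2 + B\<^sup>2 \<parallel>\<nabla>f(x)\<parallel>\<^sup>2\<close>.  With \<open>L \<gamma> \<le> \<delta>\<close> this gives a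
  decrease of \<open>\<gamma> C1 \<parallel>\<nabla>f(x)\<parallel>\<^sup>2\<close> up to a constant error (\<open>expectation_robust_model_le\<close>).

  To pass to the random iterate, which is a function of the past and hence independent of the round's
  samples, the past is frozen: the joint law of the iterate and the present is a product
  (\<open>nn_integral_freeze\<close>).  A step along \<open>a\<close> itself is also covered by the bound, so the bound never
  falls below \<open>inf f\<close>.  After subtracting \<open>inf f\<close> all integrands are nonnegative, and integrability
  propagates by induction together with the inequality (\<open>rdsgd_expected_descent\<close>).  Summing over the
  rounds telescopes the objective gaps and leaves the averaged squared gradient norm.
\<close>

section \<open>Gradients of smooth functions\<close>

lemma gradient_eqI:
  fixes f :: "'a::euclidean_space \<Rightarrow> real"
  assumes "GDERIV f x :> D"
  shows "gradient f x = D"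
proof -
  have "f differentiable (at x)"
    using assms by (auto simp: gderiv_def differentiable_def)
  then have "GDERIV f x :> gradient f x" by (rule GDERIV_gradient)
  then have "(\<lambda>h. inner h (gradient f x)) = (\<lambda>h. inner h D)"
    using assms unfolding gderiv_def by (rule has_derivative_unique)
  then have "inner (gradient f x - D) (gradient f x - D) = 0"
    by (metis (no_types) inner_diff_right right_minus_eq)
  then show ?thesis by simp
qed

lemma gradient_global_obj:
  fixes D :: "'n::finite \<Rightarrow> 'b measure"
  assumes "\<And>i. i \<in> H \<Longrightarrow> local_obj D \<l> i differentiable (at x)"
  shows "gradient (global_obj D \<l> H) x
    = (1 / real (card H)) *\<^sub>R (\<Sum>i\<in>H. gradient (local_obj D \<l> i) x)"
proof (rule gradient_eqI)
  have "(local_obj D \<l> i has_derivative (\<lambda>h. inner h (gradient (local_obj D \<l> i) x))) (at x)"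
    if "i \<in> H" for i
    using GDERIV_gradient[OF assms[OF that]] by (simp add: gderiv_def)
  then have "((\<lambda>y. (1 / real (card H)) * (\<Sum>i\<in>H. local_obj D \<l> i y)) has_derivative
      (\<lambda>h. (1 / real (card H)) * (\<Sum>i\<in>H. inner h (gradient (local_obj D \<l> i) x)))) (at x)"
    by (intro has_derivative_mult_right has_derivative_sum)
  then show "GDERIV (global_obj D \<l> H) x
      :> (1 / real (card H)) *\<^sub>R (\<Sum>i\<in>H. gradient (local_obj D \<l> i) x)"
    by (simp add: gderiv_def global_obj_def[abs_def] inner_sum_right)
qed

lemma L_smooth_continuous:
  assumes "L_smooth L f"
  shows "continuous_on UNIV f" and "continuous_on UNIV (gradient f)"
  using assms unfolding L_smooth_def
  by (blast intro: differentiable_imp_continuous_on differentiable_at_imp_differentiable_on)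
    (use assms in \<open>auto simp: L_smooth_def intro: lipschitz_on_continuous_on\<close>)

text \<open>
  The function minus its quadratic upper model is nonincreasing along the segment from \<open>x\<close> to
  \<open>x + d\<close>: by Cauchy-Schwarz and the Lipschitz bound its slope at parameter \<open>s\<close> is at most
  \<open>L s \<parallel>d\<parallel>\<^sup>2 - L s \<parallel>d\<parallel>\<^sup>2\<close>.
\<close>
lemma L_smooth_quadratic_upper_bound:
  fixes f :: "real ^ 'd \<Rightarrow> real"
  assumes "L_smooth L f"
  shows "f (x + d) \<le> f x + inner (gradient f x) d + L / 2 * (norm d)\<^sup>2"
proof -
  define \<phi> where "\<phi> s = f (x + s *\<^sub>R d) - s * inner (gradient f x) d - L / 2 * s\<^sup>2 * (norm d)\<^sup>2"
    for s :: real
  have diff: "f differentiable (at y)" for y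
    using assms by (simp add: L_smooth_def)
  have lip: "dist (gradient f y) (gradient f x) \<le> L * dist y x" for y
    using assms by (auto simp: L_smooth_def lipschitz_on_def)
  have der: "(\<phi> has_real_derivative
      (inner d (gradient f (x + s *\<^sub>R d)) - inner (gradient f x) d - L * s * (norm d)\<^sup>2)) (at s)" for s
  proof -
    have 1: "((\<lambda>s. x + s *\<^sub>R d) has_derivative (\<lambda>h. h *\<^sub>R d)) (at s)"
      by (auto intro!: derivative_eq_intros)
    have 2: "(f has_derivative (\<lambda>h. inner h (gradient f (x + s *\<^sub>R d)))) (at (x + s *\<^sub>R d))"
      using GDERIV_gradient[OF diff] by (simp add: gderiv_def)
    have "((\<lambda>s. f (x + s *\<^sub>R d)) has_derivative
        (\<lambda>h. inner (h *\<^sub>R d) (gradient f (x + s *\<^sub>R d)))) (at s)"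
      by (rule has_derivative_compose[OF 1 2])
    then have "((\<lambda>s. f (x + s *\<^sub>R d)) has_real_derivative
        inner d (gradient f (x + s *\<^sub>R d))) (at s)"
      by (simp add: has_field_derivative_def mult.commute[of _ "inner d _"])
    then show ?thesis unfolding \<phi>_def
      by (auto intro!: derivative_eq_intros)
  qed
  have "\<phi> 1 \<le> \<phi> 0"
  proof (rule DERIV_nonpos_imp_nonincreasing[of 0 1 \<phi>])
    fix s :: real assume s: "0 \<le> s" "s \<le> 1"
    have "inner d (gradient f (x + s *\<^sub>R d)) - inner (gradient f x) d
        = inner d (gradient f (x + s *\<^sub>R d) - gradient f x)"
      by (simp add: inner_diff_right inner_commute)
    also have "\<dots> \<le> norm d * norm (gradient f (x + s *\<^sub>R d) - gradient f x)"
      by (rule norm_cauchy_schwarz)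
    also have "\<dots> \<le> norm d * (L * (s * norm d))"
      using lip[of "x + s *\<^sub>R d"] s by (intro mult_left_mono) (auto simp: dist_norm)
    also have "\<dots> = L * s * (norm d)\<^sup>2"
      by (simp add: power2_eq_square)
    finally show "\<exists>y. DERIV \<phi> s :> y \<and> y \<le> 0"
      using der[of s] by (intro exI conjI) auto
  qed simp
  then show ?thesis by (simp add: \<phi>_def)
qed

section \<open>The effect of robust aggregation on one step\<close>

text \<open>
  The deviations from the mean add up to zero, so expanding around it has no cross term and moving to
  \<open>c\<close> costs \<open>card S \<parallel>mean - c\<parallel>\<^sup>2\<close>.  With \<open>c = \<nabla>f(x)\<close> this replaces the random centre in the
  robustness bound by a fixed one.
\<close>
lemma sum_norm_sq_avg_over_le:
  fixes X :: "real ^ 'd ^ 'n"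
  shows "(\<Sum>i\<in>S. (norm (X $ i - avg_over S X))\<^sup>2) \<le> (\<Sum>i\<in>S. (norm (X $ i - c))\<^sup>2)"
proof (cases "card S = 0")
  case True
  then show ?thesis by auto
next
  case False
  let ?m = "avg_over S X"
  have m: "(\<Sum>i\<in>S. X $ i) = real (card S) *\<^sub>R ?m"
    using False by (simp add: avg_over_def)
  have "(\<Sum>i\<in>S. (norm (X $ i - c))\<^sup>2)
      = (\<Sum>i\<in>S. (norm (X $ i - ?m))\<^sup>2 + 2 * inner (X $ i - ?m) (?m - c) + (norm (?m - c))\<^sup>2)"
    by (intro sum.cong refl)
      (simp add: power2_norm_eq_inner inner_diff_left inner_diff_right inner_commute)
  also have "\<dots> = (\<Sum>i\<in>S. (norm (X $ i - ?m))\<^sup>2)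
      + 2 * inner ((\<Sum>i\<in>S. X $ i) - real (card S) *\<^sub>R ?m) (?m - c) + real (card S) * (norm (?m - c))\<^sup>2"
    by (simp add: sum.distrib sum_distrib_left[symmetric] inner_sum_left[symmetric] sum_subtractf
        sum_constant_scaleR del: sum_constant)
  finally show ?thesis using m by simp
qed

text \<open>
  The descent bound for a step along any vector within squared distance \<open>\<kappa> s\<close> of \<open>a\<close>.  In the
  algorithm \<open>a\<close> is the honest average and \<open>s\<close> the mean squared distance of the honest stochastic
  gradients to \<open>\<nabla>f(x)\<close>, so that the bound does not see the Byzantine messages.
\<close>
definition robust_model ::
    "(real ^ 'd \<Rightarrow> real) \<Rightarrow> real \<Rightarrow> real \<Rightarrow> real \<Rightarrow> real ^ 'd \<Rightarrow> real ^ 'd \<Rightarrow> real \<Rightarrow> real" where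
  "robust_model f L \<gamma> \<kappa> x a s =
     f x - \<gamma> * inner (gradient f x) a + \<gamma> / 2 * (norm (gradient f x))\<^sup>2
     + L * \<gamma>\<^sup>2 * (norm a)\<^sup>2 + (\<gamma> / 2 + L * \<gamma>\<^sup>2) * \<kappa> * s"

text \<open>
  With \<open>e = r - a\<close>, the aggregation error enters the quadratic upper bound twice:
  \<open>-\<langle>\<nabla>f, e\<rangle>\<close> is absorbed by Young's inequality and \<open>\<parallel>a + e\<parallel>\<^sup>2\<close> by \<open>2\<parallel>a\<parallel>\<^sup>2 + 2\<parallel>e\<parallel>\<^sup>2\<close>.
\<close>
lemma step_le_robust_model:
  fixes f :: "real ^ 'd \<Rightarrow> real"
  assumes "L_smooth L f" and "L > 0" and "\<gamma> > 0" and e: "(norm (r - a))\<^sup>2 \<le> \<kappa> * s"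
  shows "f (x - \<gamma> *\<^sub>R r) \<le> robust_model f L \<gamma> \<kappa> x a s"
proof -
  let ?G = "gradient f x"
  have young: "- inner ?G (r - a) \<le> (norm ?G)\<^sup>2 / 2 + (norm (r - a))\<^sup>2 / 2"
    using inner_ge_zero[of "?G + (r - a)"]
    by (simp add: power2_norm_eq_inner inner_add_left inner_add_right inner_commute)
  have par: "(norm r)\<^sup>2 \<le> 2 * (norm a)\<^sup>2 + 2 * (norm (r - a))\<^sup>2"
    using inner_ge_zero[of "r - 2 *\<^sub>R a"]
    by (simp add: power2_norm_eq_inner inner_diff_left inner_diff_right inner_commute)
  have "f (x - \<gamma> *\<^sub>R r) \<le> f x - \<gamma> * inner ?G r + L / 2 * (\<gamma>\<^sup>2 * (norm r)\<^sup>2)"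
    using L_smooth_quadratic_upper_bound[OF assms(1), of x "- (\<gamma> *\<^sub>R r)"]
    by (simp add: power_mult_distrib)
  also have "\<dots> = f x - \<gamma> * inner ?G a + \<gamma> * (- inner ?G (r - a)) + L * \<gamma>\<^sup>2 / 2 * (norm r)\<^sup>2"
    by (simp add: inner_diff_right algebra_simps)
  also have "\<dots> \<le> f x - \<gamma> * inner ?G a + \<gamma> * ((norm ?G)\<^sup>2 / 2 + (norm (r - a))\<^sup>2 / 2)
      + L * \<gamma>\<^sup>2 / 2 * (2 * (norm a)\<^sup>2 + 2 * (norm (r - a))\<^sup>2)"
    using young par assms(2,3) by (intro add_mono mult_left_mono) auto
  also have "\<dots> = f x - \<gamma> * inner ?G a + \<gamma> / 2 * (norm ?G)\<^sup>2 + L * \<gamma>\<^sup>2 * (norm a)\<^sup>2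
      + (\<gamma> / 2 + L * \<gamma>\<^sup>2) * (norm (r - a))\<^sup>2"
    by (simp add: field_simps)
  also have "\<dots> \<le> robust_model f L \<gamma> \<kappa> x a s"
    unfolding robust_model_def using e assms(2,3)
    by (auto simp: mult.assoc intro!: mult_left_mono)
  finally show ?thesis .
qed

text \<open>A step along \<open>a\<close> itself is among those that the model bounds.\<close>
lemma robust_model_ge_lower_bound:
  fixes f :: "real ^ 'd \<Rightarrow> real"
  assumes "L_smooth L f" "L > 0" "\<gamma> > 0" "0 \<le> \<kappa> * s" and "\<And>y. m \<le> f y"
  shows "m \<le> robust_model f L \<gamma> \<kappa> x a s"
  using step_le_robust_model[OF assms(1-3), of a a \<kappa> s x] assms(4) assms(5)[of "x - \<gamma> *\<^sub>R a"]
  by simp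

section \<open>Moments of independent stochastic gradients\<close>

lemma (in prob_space) expectation_inner_indep:
  fixes Z :: "'n \<Rightarrow> 'a \<Rightarrow> 'v::euclidean_space"
  assumes ind: "indep_vars (\<lambda>_. borel) Z I" and "i \<in> I" "k \<in> I" "i \<noteq> k"
    and int: "integrable M (Z i)" "integrable M (Z k)"
  shows "integrable M (\<lambda>\<omega>. inner (Z i \<omega>) (Z k \<omega>))"
    and "expectation (\<lambda>\<omega>. inner (Z i \<omega>) (Z k \<omega>)) = inner (expectation (Z i)) (expectation (Z k))"
proof -
  have coord: "integrable M (\<lambda>\<omega>. inner (Z i \<omega>) v * inner (Z k \<omega>) v)
      \<and> expectation (\<lambda>\<omega>. inner (Z i \<omega>) v * inner (Z k \<omega>) v)
        = inner (expectation (Z i)) v * inner (expectation (Z k)) v" for v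
  proof -
    have "indep_vars (\<lambda>_. borel) (\<lambda>j \<omega>. inner (Z j \<omega>) v) {i, k}"
      using indep_vars_subset[OF ind, of "{i, k}"] assms(2,3)
      by (intro indep_vars_compose2[where M'="\<lambda>_. borel" and Y="\<lambda>_ u. inner u v"]) auto
    note this indep_vars_lebesgue_integral[OF _ this] indep_vars_integrable[OF _ this]
    moreover have "integrable M (\<lambda>\<omega>. inner (Z j \<omega>) v)" if "j \<in> {i, k}" for j
      using that int by auto
    ultimately show ?thesis using \<open>i \<noteq> k\<close> int by simp
  qed
  show "integrable M (\<lambda>\<omega>. inner (Z i \<omega>) (Z k \<omega>))"
    using coord by (subst euclidean_inner) auto
  show "expectation (\<lambda>\<omega>. inner (Z i \<omega>) (Z k \<omega>)) = inner (expectation (Z i)) (expectation (Z k))"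
    using coord by (subst (1 2) euclidean_inner) (simp add: Bochner_Integration.integral_sum)
qed

text \<open>Off-diagonal terms of the squared norm vanish in expectation.\<close>
lemma (in prob_space) expectation_norm_sq_sum_indep:
  fixes Z :: "'n \<Rightarrow> 'a \<Rightarrow> 'v::euclidean_space"
  assumes ind: "indep_vars (\<lambda>_. borel) Z I" and "finite I"
    and int: "\<And>i. i \<in> I \<Longrightarrow> integrable M (Z i)"
    and mean: "\<And>i. i \<in> I \<Longrightarrow> expectation (Z i) = 0"
    and sq: "\<And>i. i \<in> I \<Longrightarrow> integrable M (\<lambda>\<omega>. (norm (Z i \<omega>))\<^sup>2)"
  shows "integrable M (\<lambda>\<omega>. (norm (\<Sum>i\<in>I. Z i \<omega>))\<^sup>2)"
    and "expectation (\<lambda>\<omega>. (norm (\<Sum>i\<in>I. Z i \<omega>))\<^sup>2)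
      = (\<Sum>i\<in>I. expectation (\<lambda>\<omega>. (norm (Z i \<omega>))\<^sup>2))"
proof -
  have expand: "(norm (\<Sum>i\<in>I. Z i \<omega>))\<^sup>2 = (\<Sum>i\<in>I. \<Sum>k\<in>I. inner (Z i \<omega>) (Z k \<omega>))" for \<omega>
    by (simp add: power2_norm_eq_inner inner_sum_left inner_sum_right inner_commute)
  have pair: "integrable M (\<lambda>\<omega>. inner (Z i \<omega>) (Z k \<omega>))
      \<and> expectation (\<lambda>\<omega>. inner (Z i \<omega>) (Z k \<omega>))
        = (if i = k then expectation (\<lambda>\<omega>. (norm (Z i \<omega>))\<^sup>2) else 0)"
    if "i \<in> I" "k \<in> I" for i k
    using that expectation_inner_indep[OF ind that] int mean sq
    by (auto simp: power2_norm_eq_inner)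
  show "integrable M (\<lambda>\<omega>. (norm (\<Sum>i\<in>I. Z i \<omega>))\<^sup>2)"
    unfolding expand using pair by auto
  show "expectation (\<lambda>\<omega>. (norm (\<Sum>i\<in>I. Z i \<omega>))\<^sup>2)
      = (\<Sum>i\<in>I. expectation (\<lambda>\<omega>. (norm (Z i \<omega>))\<^sup>2))"
    unfolding expand using pair \<open>finite I\<close>
    by (simp add: Bochner_Integration.integral_sum cong: sum.cong)
qed

text \<open>Bias-variance decomposition.\<close>
lemma (in prob_space) expectation_norm_sq_diff:
  fixes Z :: "'a \<Rightarrow> 'v::euclidean_space"
  assumes int: "integrable M Z" and sq: "integrable M (\<lambda>\<omega>. (norm (Z \<omega> - expectation Z))\<^sup>2)"
  shows "integrable M (\<lambda>\<omega>. (norm (Z \<omega> - c))\<^sup>2)"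
    and "expectation (\<lambda>\<omega>. (norm (Z \<omega> - c))\<^sup>2)
      = expectation (\<lambda>\<omega>. (norm (Z \<omega> - expectation Z))\<^sup>2) + (norm (expectation Z - c))\<^sup>2"
proof -
  let ?m = "expectation Z"
  have eq: "(norm (Z \<omega> - c))\<^sup>2
      = (norm (Z \<omega> - ?m))\<^sup>2 + 2 * (inner (Z \<omega>) (?m - c) - inner ?m (?m - c)) + (norm (?m - c))\<^sup>2" for \<omega>
    by (simp add: power2_norm_eq_inner inner_diff_left inner_diff_right inner_commute)
  show "integrable M (\<lambda>\<omega>. (norm (Z \<omega> - c))\<^sup>2)"
    unfolding eq using int sq by simp
  show "expectation (\<lambda>\<omega>. (norm (Z \<omega> - c))\<^sup>2)
      = expectation (\<lambda>\<omega>. (norm (Z \<omega> - ?m))\<^sup>2) + (norm (?m - c))\<^sup>2"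
    unfolding eq using int sq by (simp add: prob_space)
qed

text \<open>
  Averaging \<open>card H\<close> uncorrelated noises divides the variance by \<open>card H\<close>.  This is the only place
  where the independence across workers enters, and the source of the \<open>1/h\<close> in the rate.
\<close>
lemma (in prob_space) honest_average_moments:
  fixes Y :: "'n \<Rightarrow> 'a \<Rightarrow> real ^ 'd"
  assumes ind: "indep_vars (\<lambda>_. borel) Y H" and H: "finite H" "H \<noteq> {}"
    and int: "\<And>i. i \<in> H \<Longrightarrow> integrable M (Y i)"
    and mean: "\<And>i. i \<in> H \<Longrightarrow> expectation (Y i) = m i"
    and sq: "\<And>i. i \<in> H \<Longrightarrow> integrable M (\<lambda>\<omega>. (norm (Y i \<omega> - m i))\<^sup>2)"
    and var: "\<And>i. i \<in> H \<Longrightarrow> expectation (\<lambda>\<omega>. (norm (Y i \<omega> - m i))\<^sup>2) \<le> v"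
    and c: "c = (1 / real (card H)) *\<^sub>R (\<Sum>i\<in>H. m i)"
  defines "a \<equiv> \<lambda>\<omega>. (1 / real (card H)) *\<^sub>R (\<Sum>i\<in>H. Y i \<omega>)"
  shows "integrable M a" and "expectation a = c"
    and "integrable M (\<lambda>\<omega>. (norm (a \<omega>))\<^sup>2)"
    and "expectation (\<lambda>\<omega>. (norm (a \<omega>))\<^sup>2) \<le> (norm c)\<^sup>2 + v / real (card H)"
proof -
  let ?h = "real (card H)"
  have h: "?h > 0" using H by (simp add: card_gt_0_iff)
  show a_int: "integrable M a"
    unfolding a_def using int by (intro integrable_scaleR_right Bochner_Integration.integrable_sum) auto
  show a_mean: "expectation a = c"
    unfolding a_def c using int mean by (simp add: Bochner_Integration.integral_sum)
  have ind': "indep_vars (\<lambda>_. borel) (\<lambda>i \<omega>. Y i \<omega> - m i) H"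
    by (rule indep_vars_compose2[OF ind]) auto
  have centred: "integrable M (\<lambda>\<omega>. Y i \<omega> - m i)" "expectation (\<lambda>\<omega>. Y i \<omega> - m i) = 0" if "i \<in> H" for i
    using int[OF that] mean[OF that] by (simp_all add: prob_space)
  note sum_sq = expectation_norm_sq_sum_indep[OF ind' H(1) centred sq]
  have dev: "(norm (a \<omega> - c))\<^sup>2 = (norm (\<Sum>i\<in>H. Y i \<omega> - m i))\<^sup>2 / ?h\<^sup>2" for \<omega>
  proof -
    have "a \<omega> - c = (1 / ?h) *\<^sub>R (\<Sum>i\<in>H. Y i \<omega> - m i)"
      by (simp add: a_def c sum_subtractf scaleR_diff_right)
    then show ?thesis by (simp add: power_divide)
  qed
  have dev_int: "integrable M (\<lambda>\<omega>. (norm (a \<omega> - expectation a))\<^sup>2)"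
    unfolding a_mean dev using sum_sq(1) by simp
  have "expectation (\<lambda>\<omega>. (norm (a \<omega> - c))\<^sup>2)
      = (\<Sum>i\<in>H. expectation (\<lambda>\<omega>. (norm (Y i \<omega> - m i))\<^sup>2)) / ?h\<^sup>2"
    unfolding dev using sum_sq(2) by simp
  also have "\<dots> \<le> (?h * v) / ?h\<^sup>2"
    using sum_bounded_above[of H "\<lambda>i. expectation (\<lambda>\<omega>. (norm (Y i \<omega> - m i))\<^sup>2)" v] var h
    by (intro divide_right_mono) auto
  also have "\<dots> = v / ?h" using h by (simp add: power2_eq_square)
  finally have dev_le: "expectation (\<lambda>\<omega>. (norm (a \<omega> - c))\<^sup>2) \<le> v / ?h" .
  show "integrable M (\<lambda>\<omega>. (norm (a \<omega>))\<^sup>2)"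
    using expectation_norm_sq_diff(1)[OF a_int dev_int, of 0] by simp
  show "expectation (\<lambda>\<omega>. (norm (a \<omega>))\<^sup>2) \<le> (norm c)\<^sup>2 + v / ?h"
    using expectation_norm_sq_diff(2)[OF a_int dev_int, of 0] dev_le a_mean by simp
qed

text \<open>
  At a fixed point \<open>x\<close> the average \<open>a\<close> is unbiased, and the mean spread \<open>s\<close> is at most the variance
  plus the dissimilarity, \<open>\<sigma>\<^sup>2 + G\<^sup>2 + B\<^sup>2 \<parallel>\<nabla>f\<parallel>\<^sup>2\<close>.  The linear term gives \<open>-\<gamma> \<parallel>\<nabla>f\<parallel>\<^sup>2\<close>, and
  \<open>L \<gamma> \<le> \<delta>\<close> turns every term quadratic in \<open>\<gamma>\<close> that multiplies \<open>\<parallel>\<nabla>f\<parallel>\<^sup>2\<close> or \<open>\<kappa>\<close> into a linear one.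
\<close>
lemma (in prob_space) expectation_robust_model_le:
  fixes Y :: "'n \<Rightarrow> 'a \<Rightarrow> real ^ 'd" and f :: "real ^ 'd \<Rightarrow> real"
  assumes ind: "indep_vars (\<lambda>_. borel) Y H" and H: "finite H" "H \<noteq> {}"
    and int: "\<And>i. i \<in> H \<Longrightarrow> integrable M (Y i)"
    and mean: "\<And>i. i \<in> H \<Longrightarrow> expectation (Y i) = m i"
    and sq: "\<And>i. i \<in> H \<Longrightarrow> integrable M (\<lambda>\<omega>. (norm (Y i \<omega> - m i))\<^sup>2)"
    and var: "\<And>i. i \<in> H \<Longrightarrow> expectation (\<lambda>\<omega>. (norm (Y i \<omega> - m i))\<^sup>2) \<le> \<sigma>\<^sup>2"
    and c: "gradient f x = (1 / real (card H)) *\<^sub>R (\<Sum>i\<in>H. m i)"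
    and dissim: "(\<Sum>i\<in>H. (norm (m i - gradient f x))\<^sup>2) / real (card H)
      \<le> G\<^sup>2 + B\<^sup>2 * (norm (gradient f x))\<^sup>2"
    and par: "L > 0" "\<kappa> > 0" "\<gamma> > 0" "L * \<gamma> \<le> \<delta>" "0 < \<delta>"
  defines "a \<equiv> \<lambda>\<omega>. (1 / real (card H)) *\<^sub>R (\<Sum>i\<in>H. Y i \<omega>)"
    and "s \<equiv> \<lambda>\<omega>. (\<Sum>i\<in>H. (norm (Y i \<omega> - gradient f x))\<^sup>2) / real (card H)"
  shows "integrable M (\<lambda>\<omega>. robust_model f L \<gamma> \<kappa> x (a \<omega>) (s \<omega>))"
    and "expectation (\<lambda>\<omega>. robust_model f L \<gamma> \<kappa> x (a \<omega>) (s \<omega>))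
      \<le> f x - \<gamma> * C1 \<delta> \<kappa> B * (norm (gradient f x))\<^sup>2
        + \<gamma> * ((1/2 + \<delta>) * (\<kappa> * \<sigma>\<^sup>2 + \<kappa> * G\<^sup>2) + 2 * \<gamma> * L * \<sigma>\<^sup>2 / real (card H))"
proof -
  let ?h = "real (card H)" and ?g = "gradient f x"
  let ?n = "(norm (gradient f x))\<^sup>2"
  have h: "?h > 0" using H by (simp add: card_gt_0_iff)
  have a_fold: "(1 / ?h) *\<^sub>R (\<Sum>i\<in>H. Y i \<omega>) = a \<omega>" for \<omega>
    by (simp add: a_def)
  note am = honest_average_moments[OF ind H int mean sq var c, unfolded a_fold]
  have dev: "integrable M (\<lambda>\<omega>. (norm (Y i \<omega> - ?g))\<^sup>2)
      \<and> expectation (\<lambda>\<omega>. (norm (Y i \<omega> - ?g))\<^sup>2) \<le> \<sigma>\<^sup>2 + (norm (m i - ?g))\<^sup>2" if "i \<in> H" for i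
    using expectation_norm_sq_diff[OF int[OF that], of ?g] mean[OF that] sq[OF that] var[OF that]
    by simp
  have s_int: "integrable M s"
    unfolding s_def using dev by auto
  have "expectation s = (\<Sum>i\<in>H. expectation (\<lambda>\<omega>. (norm (Y i \<omega> - ?g))\<^sup>2)) / ?h"
    unfolding s_def using dev by (simp add: Bochner_Integration.integral_sum)
  also have "\<dots> \<le> (\<Sum>i\<in>H. \<sigma>\<^sup>2 + (norm (m i - ?g))\<^sup>2) / ?h"
    using dev h by (intro divide_right_mono sum_mono) auto
  also have "\<dots> = \<sigma>\<^sup>2 + (\<Sum>i\<in>H. (norm (m i - ?g))\<^sup>2) / ?h"
    using h by (simp add: sum.distrib add_divide_distrib)
  also have "\<dots> \<le> \<sigma>\<^sup>2 + (G\<^sup>2 + B\<^sup>2 * ?n)" using dissim by simp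
  finally have s_le: "expectation s \<le> \<sigma>\<^sup>2 + (G\<^sup>2 + B\<^sup>2 * ?n)" .
  show "integrable M (\<lambda>\<omega>. robust_model f L \<gamma> \<kappa> x (a \<omega>) (s \<omega>))"
    unfolding robust_model_def using am(1,3) s_int by simp
  have Lg: "L * \<gamma>\<^sup>2 \<le> \<gamma> * \<delta>"
    using mult_left_mono[OF par(4), of \<gamma>] par(3) by (simp add: power2_eq_square mult_ac)
  have "expectation (\<lambda>\<omega>. robust_model f L \<gamma> \<kappa> x (a \<omega>) (s \<omega>))
      = f x - \<gamma> * inner ?g (expectation a) + \<gamma> / 2 * ?n
        + L * \<gamma>\<^sup>2 * expectation (\<lambda>\<omega>. (norm (a \<omega>))\<^sup>2) + (\<gamma> / 2 + L * \<gamma>\<^sup>2) * \<kappa> * expectation s"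
    unfolding robust_model_def using am(1,3) s_int by (simp add: prob_space)
  also have "\<dots> \<le> f x - \<gamma> * ?n + \<gamma> / 2 * ?n + L * \<gamma>\<^sup>2 * (?n + \<sigma>\<^sup>2 / ?h)
      + (\<gamma> / 2 + L * \<gamma>\<^sup>2) * \<kappa> * (\<sigma>\<^sup>2 + (G\<^sup>2 + B\<^sup>2 * ?n))"
    using am(2,4) s_le par
    by (intro add_mono mult_left_mono) (auto simp: power2_norm_eq_inner)
  also have "\<dots> \<le> f x - \<gamma> / 2 * ?n + \<gamma> * \<delta> * ?n + L * \<gamma>\<^sup>2 * (\<sigma>\<^sup>2 / ?h)
      + (\<gamma> / 2 + \<gamma> * \<delta>) * \<kappa> * (\<sigma>\<^sup>2 + (G\<^sup>2 + B\<^sup>2 * ?n))"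
  proof -
    have "L * \<gamma>\<^sup>2 * ?n \<le> \<gamma> * \<delta> * ?n" using Lg by (rule mult_right_mono) simp
    moreover have "(\<gamma> / 2 + L * \<gamma>\<^sup>2) * \<kappa> * (\<sigma>\<^sup>2 + (G\<^sup>2 + B\<^sup>2 * ?n))
        \<le> (\<gamma> / 2 + \<gamma> * \<delta>) * \<kappa> * (\<sigma>\<^sup>2 + (G\<^sup>2 + B\<^sup>2 * ?n))"
      using Lg par by (intro mult_right_mono) auto
    ultimately show ?thesis by (simp add: distrib_left)
  qed
  also have "\<dots> \<le> f x - \<gamma> * C1 \<delta> \<kappa> B * ?n
      + \<gamma> * ((1/2 + \<delta>) * (\<kappa> * \<sigma>\<^sup>2 + \<kappa> * G\<^sup>2) + 2 * \<gamma> * L * \<sigma>\<^sup>2 / ?h)"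
  proof -
    \<comment> \<open>The two sides differ by one spare \<open>\<gamma> \<delta> \<parallel>\<nabla>f\<parallel>\<^sup>2\<close> and one spare \<open>L \<gamma>\<^sup>2 \<sigma>\<^sup>2 / h\<close>.\<close>
    define q where "q = \<sigma>\<^sup>2 / ?h"
    have "2 * \<gamma> * L * \<sigma>\<^sup>2 / ?h = 2 * \<gamma> * L * q" by (simp add: q_def)
    moreover have "0 \<le> \<gamma> * \<delta> * ?n + L * \<gamma>\<^sup>2 * q" using par by (simp add: q_def)
    ultimately show ?thesis
      unfolding C1_def power2_eq_square[of \<gamma>] q_def[symmetric] by (simp add: algebra_simps)
  qed
  finally show "expectation (\<lambda>\<omega>. robust_model f L \<gamma> \<kappa> x (a \<omega>) (s \<omega>))
      \<le> f x - \<gamma> * C1 \<delta> \<kappa> B * ?n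
        + \<gamma> * ((1/2 + \<delta>) * (\<kappa> * \<sigma>\<^sup>2 + \<kappa> * G\<^sup>2) + 2 * \<gamma> * L * \<sigma>\<^sup>2 / ?h)" .
qed

section \<open>Freezing the past\<close>

text \<open>
  A past-measurable \<open>X\<close> and the identity into the \<open>\<sigma>\<close>-algebra \<open>F\<close> of the present are independent
  random elements, so their joint law is a product and Tonelli's theorem integrates the second
  one out while the first is held fixed.
\<close>
lemma (in prob_space) nn_integral_freeze:
  assumes P: "subalgebra M P" and F: "subalgebra M F" and ind: "indep_set (sets P) (sets F)"
    and X: "X \<in> measurable P S" and \<phi>[measurable]: "\<phi> \<in> borel_measurable (S \<Otimes>\<^sub>M F)"
  shows "(\<integral>\<^sup>+\<omega>. \<phi> (X \<omega>, \<omega>) \<partial>M) = (\<integral>\<^sup>+\<omega>'. \<integral>\<^sup>+\<omega>. \<phi> (X \<omega>', \<omega>) \<partial>M \<partial>M)"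
proof -
  have spP: "space P = space M" and spF: "space F = space M"
    using P F by (auto simp: subalgebra_def)
  have XM[measurable]: "X \<in> measurable M S"
    using measurable_from_subalg[OF P X] .
  have idF[measurable]: "(\<lambda>\<omega>. \<omega>) \<in> measurable M F"
    using F by (intro measurable_from_subalg[OF F]) auto
  interpret MX: prob_space "distr M S X"
    by (rule prob_space_distr) simp
  interpret MF: prob_space "distr M F (\<lambda>\<omega>. \<omega>)"
    by (rule prob_space_distr) simp
  have joint: "distr M S X \<Otimes>\<^sub>M distr M F (\<lambda>\<omega>. \<omega>) = distr M (S \<Otimes>\<^sub>M F) (\<lambda>\<omega>. (X \<omega>, \<omega>))"
  proof (rule pair_measure_eqI)
    fix U V assume "U \<in> sets (distr M S X)" and "V \<in> sets (distr M F (\<lambda>\<omega>. \<omega>))"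
    then have U[measurable]: "U \<in> sets S" and V[measurable]: "V \<in> sets F" by simp_all
    have pre: "X -` U \<inter> space M \<in> sets P"
      using measurable_sets[OF X U] by (simp add: spP)
    have VM: "V \<in> sets M" and Vs: "V \<subseteq> space M"
      using V F sets.sets_into_space[OF V] by (auto simp: subalgebra_def)
    have "emeasure (distr M S X) U * emeasure (distr M F (\<lambda>\<omega>. \<omega>)) V
        = emeasure M (X -` U \<inter> space M) * emeasure M V"
      using Vs by (simp add: emeasure_distr Int_absorb2)
    also have "\<dots> = emeasure M ((X -` U \<inter> space M) \<inter> V)"
      using indep_setD[OF ind pre V] by (simp add: emeasure_eq_measure ennreal_mult)
    also have "(X -` U \<inter> space M) \<inter> V = (\<lambda>\<omega>. (X \<omega>, \<omega>)) -` (U \<times> V) \<inter> space M"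
      by auto
    also have "emeasure M \<dots> = emeasure (distr M (S \<Otimes>\<^sub>M F) (\<lambda>\<omega>. (X \<omega>, \<omega>))) (U \<times> V)"
      by (subst emeasure_distr) simp_all
    finally show "emeasure (distr M S X) U * emeasure (distr M F (\<lambda>\<omega>. \<omega>)) V
        = emeasure (distr M (S \<Otimes>\<^sub>M F) (\<lambda>\<omega>. (X \<omega>, \<omega>))) (U \<times> V)" .
  qed (simp_all add: MX.sigma_finite_measure_axioms MF.sigma_finite_measure_axioms)
  have "(\<integral>\<^sup>+\<omega>. \<phi> (X \<omega>, \<omega>) \<partial>M) = (\<integral>\<^sup>+p. \<phi> p \<partial>distr M (S \<Otimes>\<^sub>M F) (\<lambda>\<omega>. (X \<omega>, \<omega>)))"
    by (subst nn_integral_distr) simp_all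
  also have "\<dots> = (\<integral>\<^sup>+x. \<integral>\<^sup>+\<omega>. \<phi> (x, \<omega>) \<partial>distr M F (\<lambda>\<omega>. \<omega>) \<partial>distr M S X)"
    unfolding joint[symmetric] by (subst MF.nn_integral_fst) simp_all
  also have "\<dots> = (\<integral>\<^sup>+\<omega>'. \<integral>\<^sup>+\<omega>. \<phi> (X \<omega>', \<omega>) \<partial>distr M F (\<lambda>\<omega>. \<omega>) \<partial>M)"
    by (subst nn_integral_distr) simp_all
  also have "\<dots> = (\<integral>\<^sup>+\<omega>'. \<integral>\<^sup>+\<omega>. \<phi> (X \<omega>', \<omega>) \<partial>M \<partial>M)"
    using measurable_space[OF XM]
    by (intro nn_integral_cong nn_integral_distr) auto
  finally show ?thesis .
qed

text \<open>
  A way to bound an expectation without conditioning \<open>Y\<close> itself.  The dominated variable \<open>Y\<close> may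
  depend on more than \<open>X\<close> and the present, as the next objective value does through the Byzantine
  messages; only the bound \<open>\<phi>\<close> has to be measurable in these two.  Nonnegativity of \<open>\<phi>\<close> yields the
  integrability of \<open>Y\<close> along with the inequality, since Tonelli's theorem needs none beforehand.
\<close>
lemma (in prob_space) expectation_le_frozen_bound:
  fixes \<phi> :: "'s \<times> 'a \<Rightarrow> real"
  assumes sub: "subalgebra M P" "subalgebra M F" and ind: "indep_set (sets P) (sets F)"
    and X: "X \<in> measurable P S" and \<phi>: "\<phi> \<in> borel_measurable (S \<Otimes>\<^sub>M F)"
    and nonneg: "\<And>p. 0 \<le> \<phi> p"
    and int: "\<And>x. integrable M (\<lambda>\<omega>. \<phi> (x, \<omega>))"
    and le: "\<And>x. expectation (\<lambda>\<omega>. \<phi> (x, \<omega>)) \<le> q x"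
    and qX: "integrable M (\<lambda>\<omega>. q (X \<omega>))"
    and Y: "Y \<in> borel_measurable M" "\<And>\<omega>. 0 \<le> Y \<omega>" "\<And>\<omega>. Y \<omega> \<le> \<phi> (X \<omega>, \<omega>)"
  shows "integrable M Y" and "expectation Y \<le> expectation (\<lambda>\<omega>. q (X \<omega>))"
proof -
  have q_nonneg: "0 \<le> q x" for x
    using le[of x] nonneg by (intro order_trans[OF integral_nonneg_AE le]) auto
  have "(\<integral>\<^sup>+\<omega>. ennreal (Y \<omega>) \<partial>M) \<le> (\<integral>\<^sup>+\<omega>. ennreal (\<phi> (X \<omega>, \<omega>)) \<partial>M)"
    using Y(3) by (intro nn_integral_mono ennreal_leI)
  also have "\<dots> = (\<integral>\<^sup>+\<omega>'. \<integral>\<^sup>+\<omega>. ennreal (\<phi> (X \<omega>', \<omega>)) \<partial>M \<partial>M)"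
    using nn_integral_freeze[OF sub ind X, of "\<lambda>p. ennreal (\<phi> p)"] \<phi> by simp
  also have "\<dots> \<le> (\<integral>\<^sup>+\<omega>'. ennreal (q (X \<omega>')) \<partial>M)"
    using int le nonneg
    by (intro nn_integral_mono) (simp add: nn_integral_eq_integral ennreal_leI)
  also have "\<dots> = ennreal (expectation (\<lambda>\<omega>. q (X \<omega>)))"
    using qX q_nonneg by (simp add: nn_integral_eq_integral)
  finally have bound: "(\<integral>\<^sup>+\<omega>. ennreal (Y \<omega>) \<partial>M) \<le> ennreal (expectation (\<lambda>\<omega>. q (X \<omega>)))" .
  show Y_int: "integrable M Y"
    using Y(1,2) le_less_trans[OF bound ennreal_less_top] by (intro integrableI_bounded) simp_all
  show "expectation Y \<le> expectation (\<lambda>\<omega>. q (X \<omega>))"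
    using bound q_nonneg Y(2) by (simp add: nn_integral_eq_integral[OF Y_int] ennreal_le_iff)
qed

section \<open>Measurability of the iterates\<close>

lemma borel_measurable_vec_lambda:
  fixes F :: "'n::finite \<Rightarrow> 'w \<Rightarrow> 'v::euclidean_space"
  assumes "\<And>i. F i \<in> borel_measurable N"
  shows "(\<lambda>\<omega>. \<chi> i. F i \<omega>) \<in> borel_measurable N"
proof (subst borel_measurable_euclidean_space, intro ballI)
  fix u :: "'v ^ 'n" assume "u \<in> Basis"
  then obtain i v where "u = axis i v" by (auto simp: Basis_vec_def)
  then show "(\<lambda>\<omega>. inner (\<chi> i. F i \<omega>) u) \<in> borel_measurable N"
    using assms by (simp add: inner_axis)
qed

text \<open>
  The iterate after round \<open>t\<close> is a measurable function of the inputs of rounds \<open>1\<close> to \<open>t\<close>; leaving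
  \<open>N\<close> arbitrary lets it be the \<open>\<sigma>\<close>-algebra of the past of round \<open>t + 1\<close>.
\<close>
lemma rdsgd_measurable:
  fixes g :: "'n::finite \<Rightarrow> real ^ 'd \<Rightarrow> 'b \<Rightarrow> real ^ 'd"
  assumes g: "\<And>i. i \<in> H \<Longrightarrow> case_prod (g i) \<in> borel_measurable (borel \<Otimes>\<^sub>M D i)"
    and A: "A \<in> borel_measurable borel"
    and \<xi>: "\<And>s i. 1 \<le> s \<Longrightarrow> s \<le> t \<Longrightarrow> i \<in> H \<Longrightarrow> \<xi> s i \<in> measurable N (D i)"
    and z: "\<And>s j. 1 \<le> s \<Longrightarrow> s \<le> t \<Longrightarrow> j \<notin> H \<Longrightarrow> z s j \<in> borel_measurable N"
  shows "rdsgd \<gamma> A H g \<xi> z x0 t \<in> borel_measurable N"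
  using \<xi> z
proof (induction t)
  case 0
  then show ?case by simp
next
  case (Suc t)
  let ?X = "rdsgd \<gamma> A H g \<xi> z x0 t"
  have X[measurable]: "?X \<in> borel_measurable N" using Suc by simp
  have msg: "(\<lambda>\<omega>. if i \<in> H then g i (?X \<omega>) (\<xi> (Suc t) i \<omega>) else z (Suc t) i \<omega>)
      \<in> borel_measurable N" for i
  proof (cases "i \<in> H")
    case True
    have "(\<lambda>\<omega>. (?X \<omega>, \<xi> (Suc t) i \<omega>)) \<in> measurable N (borel \<Otimes>\<^sub>M D i)"
      using X Suc.prems(1)[of "Suc t" i] True by (intro measurable_Pair) auto
    from measurable_compose[OF this g[OF True]] show ?thesis using True by simp
  next
    case False
    then show ?thesis using Suc.prems(2)[of "Suc t" i] by simp
  qed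
  note [measurable] = measurable_compose[OF borel_measurable_vec_lambda[OF msg] A]
  show ?case by simp
qed

text \<open>
  Only the \<open>\<sigma>\<close>-algebras matter here; these objects carry the zero measure, and probabilities
  are always taken under \<open>M\<close>.
\<close>
definition past_algebra where
  "past_algebra M H D \<xi> z t = sigma (space M) (past_events M H D \<xi> z t)"

definition round_algebra where
  "round_algebra M H D \<xi> t = sigma (space M) (round_events M H D \<xi> t)"

lemma
  shows space_past_algebra: "space (past_algebra M H D \<xi> z t) = space M"
    and sets_past_algebra: "sets (past_algebra M H D \<xi> z t) = past_events M H D \<xi> z t"
proof -
  have events: "past_events M H D \<xi> z t \<subseteq> Pow (space M)"
    unfolding past_events_def by (rule subsetI, rule PowI, erule sigma_sets_into_sp[rotated]) auto
  show "space (past_algebra M H D \<xi> z t) = space M"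
    by (simp add: past_algebra_def space_measure_of[OF events])
  have "sigma_sets (space M) (past_events M H D \<xi> z t) = past_events M H D \<xi> z t"
    unfolding past_events_def by (rule sigma_sets_sigma_sets_eq) auto
  then show "sets (past_algebra M H D \<xi> z t) = past_events M H D \<xi> z t"
    by (simp add: past_algebra_def sets_measure_of[OF events])
qed

lemma
  shows space_round_algebra: "space (round_algebra M H D \<xi> t) = space M"
    and sets_round_algebra: "sets (round_algebra M H D \<xi> t) = round_events M H D \<xi> t"
proof -
  have events: "round_events M H D \<xi> t \<subseteq> Pow (space M)"
    unfolding round_events_def by (rule subsetI, rule PowI, erule sigma_sets_into_sp[rotated]) auto
  show "space (round_algebra M H D \<xi> t) = space M"
    by (simp add: round_algebra_def space_measure_of[OF events])
  have "sigma_sets (space M) (round_events M H D \<xi> t) = round_events M H D \<xi> t"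
    unfolding round_events_def by (rule sigma_sets_sigma_sets_eq) auto
  then show "sets (round_algebra M H D \<xi> t) = round_events M H D \<xi> t"
    by (simp add: round_algebra_def sets_measure_of[OF events])
qed

lemma rdsgd_past_measurable:
  fixes g :: "'n::finite \<Rightarrow> real ^ 'd \<Rightarrow> 'b \<Rightarrow> real ^ 'd"
  assumes fresh: "fresh_sampling M H D \<xi> z"
    and g: "\<And>i. i \<in> H \<Longrightarrow> case_prod (g i) \<in> borel_measurable (borel \<Otimes>\<^sub>M D i)"
    and A: "A \<in> borel_measurable borel"
  shows "rdsgd \<gamma> A H g \<xi> z x0 t \<in> borel_measurable (past_algebra M H D \<xi> z (Suc t))"
proof (rule rdsgd_measurable[OF g A])
  fix s i assume s: "1 \<le> s" "s \<le> t" and i: "i \<in> H"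
  have \<xi>: "\<xi> s i \<in> measurable M (D i)"
    using fresh s i by (auto simp: fresh_sampling_def)
  show "\<xi> s i \<in> measurable (past_algebra M H D \<xi> z (Suc t)) (D i)"
  proof (rule measurableI)
    fix S assume "S \<in> sets (D i)"
    moreover have "s < Suc t" using s by simp
    ultimately show "\<xi> s i -` S \<inter> space (past_algebra M H D \<xi> z (Suc t))
        \<in> sets (past_algebra M H D \<xi> z (Suc t))"
      unfolding space_past_algebra sets_past_algebra past_events_def
      using s(1) i by (blast intro: sigma_sets.Basic)
  qed (simp add: space_past_algebra measurable_space[OF \<xi>])
next
  fix s j assume s: "1 \<le> s" "s \<le> t" and j: "j \<notin> H"
  show "z s j \<in> borel_measurable (past_algebra M H D \<xi> z (Suc t))"
  proof (rule measurableI)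
    fix S :: "(real ^ 'd) set" assume "S \<in> sets borel"
    moreover have "s < Suc t" using s by simp
    ultimately show "z s j -` S \<inter> space (past_algebra M H D \<xi> z (Suc t))
        \<in> sets (past_algebra M H D \<xi> z (Suc t))"
      unfolding space_past_algebra sets_past_algebra past_events_def
      using s(1) j by (blast intro: sigma_sets.Basic)
  qed simp
qed

lemma sample_round_measurable:
  assumes fresh: "fresh_sampling M H D \<xi> z" and "1 \<le> t" and "i \<in> H"
  shows "\<xi> t i \<in> measurable (round_algebra M H D \<xi> t) (D i)"
proof -
  have "\<xi> t i \<in> measurable M (D i)"
    using assms by (auto simp: fresh_sampling_def)
  then show ?thesis
    using assms measurable_space[of "\<xi> t i" M "D i"]
    by (intro measurableI)
      (auto simp: space_round_algebra sets_round_algebra round_events_def intro!: sigma_sets.Basic)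
qed

lemma past_round_independent:
  assumes "prob_space M" and fresh: "fresh_sampling M H D \<xi> z" and t: "1 \<le> t"
  shows "subalgebra M (past_algebra M H D \<xi> z t)" and "subalgebra M (round_algebra M H D \<xi> t)"
    and "prob_space.indep_set M (sets (past_algebra M H D \<xi> z t)) (sets (round_algebra M H D \<xi> t))"
proof -
  interpret prob_space M by fact
  have ind: "indep_set (past_events M H D \<xi> z t) (round_events M H D \<xi> t)"
    using fresh t by (simp add: fresh_sampling_def)
  then show "indep_set (sets (past_algebra M H D \<xi> z t)) (sets (round_algebra M H D \<xi> t))"
    by (simp add: sets_past_algebra sets_round_algebra)
  show "subalgebra M (past_algebra M H D \<xi> z t)" "subalgebra M (round_algebra M H D \<xi> t)"
    using indep_setD_ev1[OF ind] indep_setD_ev2[OF ind]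
    by (simp_all add: subalgebra_def space_past_algebra sets_past_algebra
        space_round_algebra sets_round_algebra)
qed

text \<open>The oracle's moment bounds under \<open>D i\<close>, transported to the underlying probability space.\<close>
lemma stochastic_gradient_moments:
  fixes g :: "'n::finite \<Rightarrow> real ^ 'd \<Rightarrow> 'b \<Rightarrow> real ^ 'd"
  assumes fresh: "fresh_sampling M H D \<xi> z" and orc: "stochastic_oracle \<sigma> M H D \<l> \<xi> g"
    and t: "1 \<le> t" and i: "i \<in> H"
  shows "integrable M (\<lambda>\<omega>. g i x (\<xi> t i \<omega>))"
    and "(\<integral>\<omega>. g i x (\<xi> t i \<omega>) \<partial>M) = gradient (local_obj D \<l> i) x"
    and "integrable M (\<lambda>\<omega>. (norm (g i x (\<xi> t i \<omega>) - gradient (local_obj D \<l> i) x))\<^sup>2)"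
    and "(\<integral>\<omega>. (norm (g i x (\<xi> t i \<omega>) - gradient (local_obj D \<l> i) x))\<^sup>2 \<partial>M) \<le> \<sigma>\<^sup>2"
proof -
  let ?m = "gradient (local_obj D \<l> i) x"
  have \<xi>: "\<xi> t i \<in> measurable M (D i)" and law: "distr M (D i) (\<xi> t i) = D i"
    using fresh t i by (auto simp: fresh_sampling_def)
  have o: "integrable (D i) (g i x)" "(\<integral>s. g i x s \<partial>D i) = ?m"
    "integrable (D i) (\<lambda>s. (norm (g i x s - ?m))\<^sup>2)" "(\<integral>s. (norm (g i x s - ?m))\<^sup>2 \<partial>D i) \<le> \<sigma>\<^sup>2"
    using orc i by (auto simp: stochastic_oracle_def)
  note [measurable] = borel_measurable_integrable[OF o(1)] borel_measurable_integrable[OF o(3)] \<xi>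
  show "integrable M (\<lambda>\<omega>. g i x (\<xi> t i \<omega>))"
    using o(1) integrable_distr_eq[OF \<xi>, of "g i x"] by (simp add: law)
  show "(\<integral>\<omega>. g i x (\<xi> t i \<omega>) \<partial>M) = ?m"
    using o(2) integral_distr[OF \<xi>, of "g i x"] by (simp add: law)
  show "integrable M (\<lambda>\<omega>. (norm (g i x (\<xi> t i \<omega>) - ?m))\<^sup>2)"
    using o(3) integrable_distr_eq[OF \<xi>, of "\<lambda>s. (norm (g i x s - ?m))\<^sup>2"] by (simp add: law)
  show "(\<integral>\<omega>. (norm (g i x (\<xi> t i \<omega>) - ?m))\<^sup>2 \<partial>M) \<le> \<sigma>\<^sup>2"
    using o(4) integral_distr[OF \<xi>, of "\<lambda>s. (norm (g i x s - ?m))\<^sup>2"] by (simp add: law)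
qed

section \<open>One round in expectation\<close>

text \<open>
  The frozen bound, with the robust model minus a lower bound \<open>fs\<close> of the objective as \<open>\<phi>\<close>.
  Subtracting \<open>fs\<close> makes everything nonnegative; this is how integrability is carried from one
  round to the next even when the Byzantine messages have no moments.
\<close>
lemma rdsgd_expected_descent:
  fixes D :: "'n::finite \<Rightarrow> 'b measure" and \<l> :: "real ^ 'd \<Rightarrow> 'b \<Rightarrow> real"
    and A :: "real ^ 'd ^ 'n \<Rightarrow> real ^ 'd" and x0 :: "real ^ 'd" and M :: "'w measure"
  assumes H: "2 * b < CARD('n)" "card H = CARD('n) - b"
    and M: "prob_space M"
    and diff: "\<And>i x. i \<in> H \<Longrightarrow> local_obj D \<l> i differentiable (at x)"
    and fs: "\<And>x. fs \<le> global_obj D \<l> H x"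
    and fresh: "fresh_sampling M H D \<xi> z"
    and L: "L > 0" and smooth: "L_smooth L (global_obj D \<l> H)"
    and dissim: "bounded_dissimilarity G B D \<l> H"
    and orc: "stochastic_oracle \<sigma> M H D \<l> \<xi> g"
    and \<kappa>: "\<kappa> > 0" and rob: "robust_aggregator b \<kappa> A" and A: "A \<in> borel_measurable borel"
    and step: "\<gamma>s (Suc t) = \<gamma>" "0 < \<gamma>" "L * \<gamma> \<le> \<delta>" "0 < \<delta>" and C1: "C1 \<delta> \<kappa> B > 0"
  defines "f \<equiv> global_obj D \<l> H" and "X \<equiv> rdsgd \<gamma>s A H g \<xi> z x0"
    and "K \<equiv> (1/2 + \<delta>) * (\<kappa> * \<sigma>\<^sup>2 + \<kappa> * G\<^sup>2) + 2 * \<gamma> * L * \<sigma>\<^sup>2 / real (card H)"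
  assumes int: "integrable M (\<lambda>\<omega>. f (X t \<omega>) - fs)"
  shows "integrable M (\<lambda>\<omega>. (norm (gradient f (X t \<omega>)))\<^sup>2)"
    and "integrable M (\<lambda>\<omega>. f (X (Suc t) \<omega>) - fs)"
    and "(\<integral>\<omega>. f (X (Suc t) \<omega>) - fs \<partial>M)
      \<le> (\<integral>\<omega>. f (X t \<omega>) - fs \<partial>M)
        - \<gamma> * C1 \<delta> \<kappa> B * (\<integral>\<omega>. (norm (gradient f (X t \<omega>)))\<^sup>2 \<partial>M) + \<gamma> * K"
proof -
  interpret prob_space M by fact
  let ?h = "real (card H)" and ?P = "past_algebra M H D \<xi> z (Suc t)"
    and ?F = "round_algebra M H D \<xi> (Suc t)"
  have h: "?h > 0" and Hne: "H \<noteq> {}" and Hfin: "finite H"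
    using H by auto
  define a where "a x \<omega> = (1 / ?h) *\<^sub>R (\<Sum>i\<in>H. g i x (\<xi> (Suc t) i \<omega>))" for x \<omega>
  define s where "s x \<omega> = (\<Sum>i\<in>H. (norm (g i x (\<xi> (Suc t) i \<omega>) - gradient f x))\<^sup>2) / ?h" for x \<omega>
  define \<phi> where "\<phi> p = robust_model f L \<gamma> \<kappa> (fst p) (a (fst p) (snd p)) (s (fst p) (snd p)) - fs" for p
  define q where "q x = f x - fs - \<gamma> * C1 \<delta> \<kappa> B * (norm (gradient f x))\<^sup>2 + \<gamma> * K" for x

  have smooth: "L_smooth L f" and fs: "\<And>x. fs \<le> f x"
    using smooth fs by (simp_all add: f_def)
  note [measurable] = borel_measurable_continuous_onI[OF L_smooth_continuous(1)[OF smooth]]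
    borel_measurable_continuous_onI[OF L_smooth_continuous(2)[OF smooth]]
  have g: "\<And>i. i \<in> H \<Longrightarrow> case_prod (g i) \<in> borel_measurable (borel \<Otimes>\<^sub>M D i)"
    using orc by (simp add: stochastic_oracle_def)
  note indep = past_round_independent[OF M fresh, of "Suc t", simplified]
  have XP: "X r \<in> borel_measurable (past_algebra M H D \<xi> z (Suc r))" for r
    unfolding X_def by (rule rdsgd_past_measurable[OF fresh g A])
  have XM[measurable]: "X r \<in> borel_measurable M" for r
    by (rule measurable_from_subalg[OF past_round_independent(1)[OF M fresh] XP]) simp

  have s_nonneg: "0 \<le> s x \<omega>" for x \<omega>
    unfolding s_def by (intro divide_nonneg_nonneg sum_nonneg) auto
  have \<phi>_nonneg: "0 \<le> \<phi> p" for p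
    using robust_model_ge_lower_bound[OF smooth L step(2) _ fs] s_nonneg \<kappa>
    by (simp add: \<phi>_def)
  have \<phi>_meas: "\<phi> \<in> borel_measurable (borel \<Otimes>\<^sub>M ?F)"
  proof -
    have msg: "(\<lambda>p. g i (fst p) (\<xi> (Suc t) i (snd p))) \<in> borel_measurable (borel \<Otimes>\<^sub>M ?F)"
      if i: "i \<in> H" for i
    proof -
      have [measurable]: "\<xi> (Suc t) i \<in> measurable ?F (D i)"
        using sample_round_measurable[OF fresh _ i, of "Suc t"] by simp
      have "(\<lambda>p. (fst p, \<xi> (Suc t) i (snd p))) \<in> measurable (borel \<Otimes>\<^sub>M ?F) (borel \<Otimes>\<^sub>M D i)"
        by measurable
      from measurable_compose[OF this g[OF i]] show ?thesis by simp
    qed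
    have [measurable]: "(\<lambda>p. a (fst p) (snd p)) \<in> borel_measurable (borel \<Otimes>\<^sub>M ?F)"
      unfolding a_def using msg by (intro borel_measurable_scaleR borel_measurable_sum) auto
    have [measurable]: "(\<lambda>p. s (fst p) (snd p)) \<in> borel_measurable (borel \<Otimes>\<^sub>M ?F)"
      unfolding s_def using msg
      by (intro borel_measurable_divide borel_measurable_sum borel_measurable_power
          borel_measurable_norm borel_measurable_diff) auto
    show ?thesis unfolding \<phi>_def robust_model_def by measurable
  qed

  have frozen: "integrable M (\<lambda>\<omega>. \<phi> (x, \<omega>)) \<and> expectation (\<lambda>\<omega>. \<phi> (x, \<omega>)) \<le> q x" for x
  proof -
    have ind: "indep_vars (\<lambda>_. borel) (\<lambda>i \<omega>. g i x (\<xi> (Suc t) i \<omega>)) H"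
      using orc by (simp add: stochastic_oracle_def)
    have grad: "gradient f x = (1 / ?h) *\<^sub>R (\<Sum>i\<in>H. gradient (local_obj D \<l> i) x)"
      unfolding f_def using diff by (rule gradient_global_obj)
    have dis: "(\<Sum>i\<in>H. (norm (gradient (local_obj D \<l> i) x - gradient f x))\<^sup>2) / ?h
        \<le> G\<^sup>2 + B\<^sup>2 * (norm (gradient f x))\<^sup>2"
      using dissim by (simp add: bounded_dissimilarity_def f_def)
    note mom = stochastic_gradient_moments[OF fresh orc, of "Suc t" _ x, simplified]
    note model = expectation_robust_model_le[OF ind Hfin Hne mom grad dis L \<kappa> step(2-4),
        folded a_def s_def K_def]
    show ?thesis
      using model by (simp add: \<phi>_def q_def prob_space)
  qed

  \<comment> \<open>Nonnegativity of the model already dominates the squared gradient by the objective gap.\<close>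
  have grad_le: "\<gamma> * C1 \<delta> \<kappa> B * (norm (gradient f x))\<^sup>2 \<le> f x - fs + \<gamma> * K" for x
  proof -
    have "0 \<le> expectation (\<lambda>\<omega>. \<phi> (x, \<omega>))"
      using \<phi>_nonneg by (intro integral_nonneg_AE) auto
    also have "\<dots> \<le> q x" using frozen by simp
    finally show ?thesis by (simp add: q_def)
  qed
  have "integrable M (\<lambda>\<omega>. \<gamma> * C1 \<delta> \<kappa> B * (norm (gradient f (X t \<omega>)))\<^sup>2)"
  proof (rule Bochner_Integration.integrable_bound[where f="\<lambda>\<omega>. f (X t \<omega>) - fs + \<gamma> * K"])
    show "integrable M (\<lambda>\<omega>. f (X t \<omega>) - fs + \<gamma> * K)"
      using int by (intro Bochner_Integration.integrable_add) auto
    show "AE \<omega> in M. norm (\<gamma> * C1 \<delta> \<kappa> B * (norm (gradient f (X t \<omega>)))\<^sup>2)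
        \<le> norm (f (X t \<omega>) - fs + \<gamma> * K)"
    proof (rule AE_I2)
      fix \<omega>
      have "0 \<le> \<gamma> * C1 \<delta> \<kappa> B * (norm (gradient f (X t \<omega>)))\<^sup>2"
        using step(2) C1 by simp
      then show "norm (\<gamma> * C1 \<delta> \<kappa> B * (norm (gradient f (X t \<omega>)))\<^sup>2)
          \<le> norm (f (X t \<omega>) - fs + \<gamma> * K)"
        using grad_le[of "X t \<omega>"] by simp
    qed
  qed simp
  then show grad_int: "integrable M (\<lambda>\<omega>. (norm (gradient f (X t \<omega>)))\<^sup>2)"
    using step(2) C1 by simp
  have q_int: "integrable M (\<lambda>\<omega>. q (X t \<omega>))"
    unfolding q_def using int grad_int by simp

  have descent: "f (X (Suc t) \<omega>) - fs \<le> \<phi> (X t \<omega>, \<omega>)" for \<omega>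
  proof -
    let ?V = "\<chi> i. if i \<in> H then g i (X t \<omega>) (\<xi> (Suc t) i \<omega>) else z (Suc t) i \<omega>"
    have avg: "avg_over H ?V = a (X t \<omega>) \<omega>"
      by (simp add: avg_over_def a_def)
    have "(norm (A ?V - avg_over H ?V))\<^sup>2
        \<le> \<kappa> / ?h * (\<Sum>i\<in>H. (norm (?V $ i - avg_over H ?V))\<^sup>2)"
      using rob[unfolded robust_aggregator_def, rule_format, OF H(2), of ?V] by (simp only: H(2))
    also have "\<dots> \<le> \<kappa> / ?h * (\<Sum>i\<in>H. (norm (?V $ i - gradient f (X t \<omega>)))\<^sup>2)"
      using \<kappa> by (intro mult_left_mono sum_norm_sq_avg_over_le) auto
    also have "\<dots> = \<kappa> * s (X t \<omega>) \<omega>"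
      by (simp add: s_def)
    finally have "(norm (A ?V - a (X t \<omega>) \<omega>))\<^sup>2 \<le> \<kappa> * s (X t \<omega>) \<omega>"
      unfolding avg .
    from step_le_robust_model[OF smooth L step(2) this, of "X t \<omega>"]
    moreover have "X (Suc t) \<omega> = X t \<omega> - \<gamma> *\<^sub>R A ?V"
      unfolding X_def by (simp add: step(1))
    ultimately show ?thesis by (simp add: \<phi>_def)
  qed
  have next_meas: "(\<lambda>\<omega>. f (X (Suc t) \<omega>) - fs) \<in> borel_measurable M"
    by measurable
  note bound = expectation_le_frozen_bound[OF indep XP \<phi>_meas \<phi>_nonneg
      conjunct1[OF frozen] conjunct2[OF frozen] q_int next_meas _ descent]
  show "integrable M (\<lambda>\<omega>. f (X (Suc t) \<omega>) - fs)"
    using bound(1) fs by simp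
  show "(\<integral>\<omega>. f (X (Suc t) \<omega>) - fs \<partial>M)
      \<le> (\<integral>\<omega>. f (X t \<omega>) - fs \<partial>M)
        - \<gamma> * C1 \<delta> \<kappa> B * (\<integral>\<omega>. (norm (gradient f (X t \<omega>)))\<^sup>2 \<partial>M) + \<gamma> * K"
  proof -
    have "(\<integral>\<omega>. f (X (Suc t) \<omega>) - fs \<partial>M) \<le> expectation (\<lambda>\<omega>. q (X t \<omega>))"
      using bound(2) fs by simp
    also have "\<dots> = (\<integral>\<omega>. f (X t \<omega>) - fs \<partial>M)
        - \<gamma> * C1 \<delta> \<kappa> B * (\<integral>\<omega>. (norm (gradient f (X t \<omega>)))\<^sup>2 \<partial>M) + \<gamma> * K"
      unfolding q_def by (simp only: Bochner_Integration.integral_add Bochner_Integration.integral_diff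
          Bochner_Integration.integrable_diff integrable_mult_right int grad_int integrable_const
          Bochner_Integration.integral_mult_right_zero) (simp add: prob_space)
    finally show ?thesis .
  qed
qed

section \<open>The convergence rate\<close>

text \<open>
  Summing the decrease over \<open>n\<close> rounds leaves \<open>V n - V 0\<close>, of which \<open>V n\<close> is nonnegative.
\<close>
lemma average_le_of_decrease:
  fixes V N :: "nat \<Rightarrow> real"
  assumes dec: "\<And>t. V (Suc t) \<le> V t - \<gamma> * c * N t + \<gamma> * k" and V: "0 \<le> V n"
    and pos: "0 < \<gamma>" "0 < c" "0 < n"
  shows "(\<Sum>t<n. N t) / real n \<le> V 0 / (c * \<gamma> * real n) + k / c"
proof -
  have "V m + \<gamma> * c * (\<Sum>t<m. N t) \<le> V 0 + real m * (\<gamma> * k)" for m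
  proof (induction m)
    case (Suc m)
    then show ?case using dec[of m] by (simp add: algebra_simps)
  qed simp
  then have "\<gamma> * c * (\<Sum>t<n. N t) \<le> V 0 + real n * (\<gamma> * k)"
    using V by (smt (verit))
  then have "(\<gamma> * c * (\<Sum>t<n. N t)) / (c * \<gamma> * real n)
      \<le> (V 0 + real n * (\<gamma> * k)) / (c * \<gamma> * real n)"
    using pos by (intro divide_right_mono) auto
  then show ?thesis using pos by (simp add: add_divide_distrib)
qed

lemma rate_constants:
  "((1/2 + \<delta>) * (\<kappa> * \<sigma>\<^sup>2 + \<kappa> * G\<^sup>2) + 2 * \<gamma> * L * \<sigma>\<^sup>2 / h) / C1 \<delta> \<kappa> B
    = 2 * \<gamma> * L * \<sigma>\<^sup>2 / (C1 \<delta> \<kappa> B * h) + C2 \<delta> \<kappa> B * (\<kappa> * \<sigma>\<^sup>2 + \<kappa> * G\<^sup>2)"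
proof -
  have "(w * u + v / h) / c = v / (c * h) + w * inverse c * u" for u v w c :: real
    by (simp add: divide_inverse algebra_simps)
  then show ?thesis unfolding C2_def .
qed

lemma C1_pos:
  assumes "0 < \<delta>" and "\<kappa> * B\<^sup>2 < (1 - 4 * \<delta>) / (1 + 2 * \<delta>)"
  shows "C1 \<delta> \<kappa> B > 0"
  using assms unfolding C1_def by (simp add: pos_less_divide_eq algebra_simps)

text \<open>Indeed \<open>C1 = (1/2 + \<delta>) (1 - \<kappa> B\<^sup>2) - 3 \<delta>\<close>, and \<open>C1\<close> is positive on the region.\<close>
lemma C1_bigo:
  assumes "0 < \<delta>" and "\<delta> < 1/4"
  shows "(\<lambda>(\<kappa>, B). C1 \<delta> \<kappa> B)
    \<in> O[principal {(\<kappa>, B). \<kappa> > 0 \<and> B \<ge> 0 \<and> \<kappa> * B\<^sup>2 < (1 - 4 * \<delta>) / (1 + 2 * \<delta>)}](\<lambda>(\<kappa>, B). 1 - \<kappa> * B\<^sup>2)"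
proof (rule bigoI[where c = "1/2 + \<delta>"], unfold eventually_principal, clarify)
  fix \<kappa> B :: real
  assume u: "\<kappa> * B\<^sup>2 < (1 - 4 * \<delta>) / (1 + 2 * \<delta>)"
  have "0 < C1 \<delta> \<kappa> B"
    using C1_pos[OF assms(1) u] .
  moreover have "C1 \<delta> \<kappa> B = (1/2 + \<delta>) * (1 - \<kappa> * B\<^sup>2) - 3 * \<delta>"
    by (simp add: C1_def algebra_simps)
  moreover have "(1/2 + \<delta>) * (1 - \<kappa> * B\<^sup>2) \<le> (1/2 + \<delta>) * \<bar>1 - \<kappa> * B\<^sup>2\<bar>"
    using assms by (intro mult_left_mono) auto
  ultimately have "0 < C1 \<delta> \<kappa> B" and "C1 \<delta> \<kappa> B \<le> (1/2 + \<delta>) * \<bar>1 - \<kappa> * B\<^sup>2\<bar>"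
    using assms by linarith+
  then show "norm (C1 \<delta> \<kappa> B) \<le> (1/2 + \<delta>) * norm (1 - \<kappa> * B\<^sup>2)"
    by (simp only: real_norm_def abs_of_pos)
qed

theorem theorem3p1:
  fixes M :: "'w measure"
    and D :: "'n::finite \<Rightarrow> 'b measure"
    and \<l> :: "real ^ 'd \<Rightarrow> 'b \<Rightarrow> real"
    and g :: "'n \<Rightarrow> real ^ 'd \<Rightarrow> 'b \<Rightarrow> real ^ 'd"
    and A :: "real ^ 'd ^ 'n \<Rightarrow> real ^ 'd"
    and \<xi> :: "nat \<Rightarrow> 'n \<Rightarrow> 'w \<Rightarrow> 'b"
    and z :: "nat \<Rightarrow> 'n \<Rightarrow> 'w \<Rightarrow> real ^ 'd"
    and x0 :: "real ^ 'd"
    and H :: "'n set"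
    and b h T :: nat
    and L G B \<sigma> \<kappa> \<delta> \<gamma> :: real
    and \<gamma>s :: "nat \<Rightarrow> real"
  assumes "2 * b < CARD('n)" and "h = CARD('n) - b" and "card H = h"
    and "prob_space M" and "\<And>i. i \<in> H \<Longrightarrow> prob_space (D i)"
    and "\<And>i x. i \<in> H \<Longrightarrow> integrable (D i) (\<l> x)"
    and "\<And>i x. i \<in> H \<Longrightarrow> local_obj D \<l> i differentiable (at x)"
    and "bdd_below (range (global_obj D \<l> H))"
    and "fresh_sampling M H D \<xi> z"
    and "L > 0" and "L_smooth L (global_obj D \<l> H)"
    and "G \<ge> 0" and "B \<ge> 0" and "bounded_dissimilarity G B D \<l> H"
    and "stochastic_oracle \<sigma> M H D \<l> \<xi> g"
    and "\<kappa> > 0" and "robust_aggregator b \<kappa> A" and "A \<in> borel_measurable borel"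
    and "0 < \<delta>" and "\<delta> < 1/4"
    and "\<kappa> * B\<^sup>2 < (1 - 4 * \<delta>) / (1 + 2 * \<delta>)"
    and "\<And>t. t \<ge> 1 \<Longrightarrow> \<gamma>s t = \<gamma>" and "0 < \<gamma>" and "\<gamma> \<le> \<delta> / L"
    and "T > 0"
  shows "(\<forall>t<T. integrable M
           (\<lambda>\<omega>. (norm (gradient (global_obj D \<l> H) (rdsgd \<gamma>s A H g \<xi> z x0 t \<omega>)))\<^sup>2)) \<and>
         (\<Sum>t<T. \<integral>\<omega>. (norm (gradient (global_obj D \<l> H) (rdsgd \<gamma>s A H g \<xi> z x0 t \<omega>)))\<^sup>2 \<partial>M) / real T
         \<le> (global_obj D \<l> H x0 - (INF x. global_obj D \<l> H x)) / (C1 \<delta> \<kappa> B * \<gamma> * real T)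
           + 2 * \<gamma> * L * \<sigma>\<^sup>2 / (C1 \<delta> \<kappa> B * real h)
           + C2 \<delta> \<kappa> B * (\<kappa> * \<sigma>\<^sup>2 + \<kappa> * G\<^sup>2) \<and>
         (\<lambda>(\<kappa>, B). C1 \<delta> \<kappa> B)
         \<in> O[principal {(\<kappa>, B). \<kappa> > 0 \<and> B \<ge> 0 \<and> \<kappa> * B\<^sup>2 < (1 - 4 * \<delta>) / (1 + 2 * \<delta>)}](\<lambda>(\<kappa>, B). 1 - \<kappa> * B\<^sup>2)"
proof (intro conjI allI impI)
  let ?f = "global_obj D \<l> H" and ?X = "rdsgd \<gamma>s A H g \<xi> z x0"
  let ?C = "C1 \<delta> \<kappa> B" and ?fs = "INF x. global_obj D \<l> H x"
  let ?N = "\<lambda>t. \<integral>\<omega>. (norm (gradient ?f (?X t \<omega>)))\<^sup>2 \<partial>M"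
  let ?V = "\<lambda>t. \<integral>\<omega>. ?f (?X t \<omega>) - ?fs \<partial>M"
  let ?K = "(1/2 + \<delta>) * (\<kappa> * \<sigma>\<^sup>2 + \<kappa> * G\<^sup>2) + 2 * \<gamma> * L * \<sigma>\<^sup>2 / real (card H)"
  interpret prob_space M by fact
  have C: "?C > 0" using assms by (intro C1_pos)
  have fs: "?fs \<le> ?f x" for x
    using assms(8) by (intro cINF_lower) auto
  have L\<gamma>: "L * \<gamma> \<le> \<delta>"
    using assms(10,24) by (simp add: pos_le_divide_eq mult.commute)
  have cardH: "card H = CARD('n) - b" using assms by simp
  have step: "\<gamma>s (Suc t) = \<gamma>" for t using assms(22) by simp
  note round = rdsgd_expected_descent[where \<gamma>s = \<gamma>s, OF assms(1) cardH assms(4,7) fs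
      assms(9-11,14-18) step assms(23) L\<gamma> assms(19) C]
  have int: "integrable M (\<lambda>\<omega>. ?f (?X t \<omega>) - ?fs)" for t
  proof (induction t)
    case (Suc t)
    then show ?case by (rule round(2)[rotated])
  qed simp
  show "integrable M (\<lambda>\<omega>. (norm (gradient ?f (?X t \<omega>)))\<^sup>2)" for t
    using int by (rule round(1)[rotated])
  have decrease: "?V (Suc t) \<le> ?V t - \<gamma> * ?C * ?N t + \<gamma> * ?K" for t
    using int by (rule round(3)[rotated])
  have gap: "0 \<le> ?V T"
    using fs by (intro integral_nonneg_AE) auto
  have start: "?V 0 = ?f x0 - ?fs"
    by (simp add: prob_space)
  have "(\<Sum>t<T. ?N t) / real T \<le> ?V 0 / (?C * \<gamma> * real T) + ?K / ?C"
    by (rule average_le_of_decrease[where V = ?V and N = ?N, OF decrease gap assms(23) C assms(25)])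
  then show "(\<Sum>t<T. ?N t) / real T \<le> (?f x0 - ?fs) / (?C * \<gamma> * real T)
      + 2 * \<gamma> * L * \<sigma>\<^sup>2 / (?C * real h) + C2 \<delta> \<kappa> B * (\<kappa> * \<sigma>\<^sup>2 + \<kappa> * G\<^sup>2)"
    unfolding start rate_constants assms(3) by (simp only: add.assoc)
next
  show "(\<lambda>(\<kappa>, B). C1 \<delta> \<kappa> B)
    \<in> O[principal {(\<kappa>, B). \<kappa> > 0 \<and> B \<ge> 0 \<and> \<kappa> * B\<^sup>2 < (1 - 4 * \<delta>) / (1 + 2 * \<delta>)}](\<lambda>(\<kappa>, B). 1 - \<kappa> * B\<^sup>2)"
    using assms(19,20) by (rule C1_bigo)
qed

end
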